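(* Let $\lambda$ be a nonzero real number, let $n\ge0$ be an integer, and let $\alpha$ be a complex number with $\alpha+j\neq0$ for $j=0,1,\dots,n$. Then $$ \beta_{n,\lambda}^{(\alpha)}=\alpha\binom{\alpha+n}{n}\sum_{j=0}^{n}(-1)^{j}\binom{n}{j}\frac{1}{(\alpha+j)\binom{n+j}{n}}{n+j \brace j}_{\lambda}. $$
   Context: The degenerate exponential is $e_\lambda(t)=(1+\lambda t)^{1/\lambda}$. The degenerate Bernoulli numbers of order $\alpha$ are defined by the power series expansion $\big(\frac{t}{e_\lambda(t)-1}\big)^{\alpha}=\sum_{n=0}^{\infty}\beta_{n,\lambda}^{(\alpha)}\frac{t^n}{n!}$ (the base has constant term $1$). For a real parameter $\mu$ the degenerate falling factorials are $(x)_{0,\mu}=1$, $(x)_{n,\mu}=x(x-\mu)\cdots(x-(n-1)\mu)$ for $n\ge1$; $(x)_n=(x)_{n,1}$, and $\binom{y}{m}=(y)_m/m!$ for any complex $y$. The degenerate Stirling numbers of the second kind ${n \brace k}_{\mu}$ are defined by $(x)_{n,\mu}=\sum_{k=0}^{n}{n \brace k}_{\mu}(x)_k$. *)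

theory Defs
  imports Complex_Main "HOL-Computational_Algebra.Formal_Power_Series"
begin

text \<open>Complex powers of a formal power series with constant term 1:
  \<open>f\<^sup>a = (1 + (f - 1))\<^sup>a\<close> is expanded by the binomial series. The definition is only
  meaningful if the constant term of \<open>f\<close> is 1.\<close>

definition fps_cpow :: "complex fps \<Rightarrow> complex \<Rightarrow> complex fps" where
  "fps_cpow f a = fps_binomial a oo (f - 1)"

lemma fps_cpow_of_nat:
  assumes "fps_nth f 0 = 1"
  shows "fps_cpow f (of_nat n) = f ^ n"
  using assms unfolding fps_cpow_def
  by (simp add: fps_binomial_of_nat fps_compose_add_distrib flip: fps_compose_power)

lemma fps_cpow_add:
  assumes "fps_nth f 0 = 1"
  shows "fps_cpow f (a + b) = fps_cpow f a * fps_cpow f b"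
  using assms unfolding fps_cpow_def
  by (simp add: fps_binomial_add_mult fps_compose_mult_distrib)

definition deg_exp :: "real \<Rightarrow> complex fps" where
  "deg_exp l = fps_cpow (1 + fps_const (of_real l) * fps_X) (1 / of_real l)"

lemma deg_exp_nth:
  "fps_nth (deg_exp l) n = ((1 / of_real l) gchoose n) * of_real l ^ n"
  unfolding deg_exp_def fps_cpow_def
  by (simp add: fps_compose_linear)

text \<open>The quotient is exact: for \<open>l \<noteq> 0\<close> numerator and denominator both have subdegree 1.\<close>

definition deg_bernoulli_base :: "real \<Rightarrow> complex fps" where
  "deg_bernoulli_base l = fps_X / (deg_exp l - 1)"

lemma deg_bernoulli_base_mult:
  assumes "l \<noteq> 0"
  shows "deg_bernoulli_base l * (deg_exp l - 1) = fps_X"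
    and "fps_nth (deg_bernoulli_base l) 0 = 1"
proof -
  have c0: "fps_nth (deg_exp l - 1) 0 = 0" and c1: "fps_nth (deg_exp l - 1) 1 = 1"
    using assms by (simp_all add: deg_exp_nth)
  have sd: "subdegree (deg_exp l - 1) = 1"
    using c0 c1 by (intro subdegreeI) auto
  have nz: "deg_exp l - 1 \<noteq> 0"
    using sd by auto
  have "(deg_exp l - 1) dvd fps_X"
    using nz sd by (simp add: fps_dvd_iff)
  then show m: "deg_bernoulli_base l * (deg_exp l - 1) = fps_X"
    unfolding deg_bernoulli_base_def by simp
  have "fps_nth (deg_bernoulli_base l * (deg_exp l - 1)) 1 = 1"
    unfolding m by simp
  then show "fps_nth (deg_bernoulli_base l) 0 = 1"
    using c0 c1 by (simp add: fps_mult_nth)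
qed

definition deg_bernoulli :: "real \<Rightarrow> complex \<Rightarrow> nat \<Rightarrow> complex" where
  "deg_bernoulli l a n = fact n * fps_nth (fps_cpow (deg_bernoulli_base l) a) n"

definition deg_ffact :: "real \<Rightarrow> nat \<Rightarrow> real \<Rightarrow> real" where
  "deg_ffact \<mu> n x = (\<Prod>i<n. x - of_nat i * \<mu>)"

text \<open>The coefficients are indexed by all of \<open>nat\<close>; the support condition makes the family unique.\<close>

definition deg_stirling2_family :: "real \<Rightarrow> nat \<Rightarrow> (nat \<Rightarrow> real) \<Rightarrow> bool" where
  "deg_stirling2_family \<mu> n c \<longleftrightarrow>
     (\<forall>x. deg_ffact \<mu> n x = (\<Sum>k=0..n. c k * deg_ffact 1 k x)) \<and> (\<forall>k>n. c k = 0)"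

definition deg_stirling2 :: "real \<Rightarrow> nat \<Rightarrow> nat \<Rightarrow> real" where
  "deg_stirling2 \<mu> n = (THE c. deg_stirling2_family \<mu> n c)"

lemma deg_stirling2_family_exists: "\<exists>c. deg_stirling2_family \<mu> n c"
proof (induction n)
  case 0
  show ?case
    by (rule exI[of _ "\<lambda>k. if k = 0 then 1 else 0"])
       (simp add: deg_stirling2_family_def deg_ffact_def)
next
  case (Suc n)
  then obtain c where c: "\<And>x. deg_ffact \<mu> n x = (\<Sum>k=0..n. c k * deg_ffact 1 k x)"
    and c0: "\<And>k. k > n \<Longrightarrow> c k = 0"
    unfolding deg_stirling2_family_def by blast
  define d where
    "d k = (if k = 0 then 0 else c (k - 1)) + (real k - real n * \<mu>) * c k" for k
  have "deg_ffact \<mu> (Suc n) x = (\<Sum>k=0..Suc n. d k * deg_ffact 1 k x)" for x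
  proof -
    have "deg_ffact \<mu> (Suc n) x = (\<Sum>k=0..n. c k * deg_ffact 1 k x * (x - real n * \<mu>))"
      unfolding sum_distrib_right[symmetric] c[symmetric] by (simp add: deg_ffact_def)
    also have "\<dots> = (\<Sum>k=0..n. c k * deg_ffact 1 (Suc k) x)
        + (\<Sum>k=0..n. (real k - real n * \<mu>) * c k * deg_ffact 1 k x)"
      unfolding sum.distrib[symmetric]
      by (intro sum.cong refl) (simp add: deg_ffact_def algebra_simps)
    also have "(\<Sum>k=0..n. c k * deg_ffact 1 (Suc k) x) =
        (\<Sum>k=0..Suc n. (if k = 0 then 0 else c (k - 1)) * deg_ffact 1 k x)"
      by (subst sum.atLeast0_atMost_Suc_shift) simp
    also have "(\<Sum>k=0..n. (real k - real n * \<mu>) * c k * deg_ffact 1 k x) =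
        (\<Sum>k=0..Suc n. (real k - real n * \<mu>) * c k * deg_ffact 1 k x)"
      using c0 by simp
    finally show ?thesis
      unfolding d_def sum.distrib[symmetric] by (simp add: algebra_simps)
  qed
  moreover have "d k = 0" if "k > Suc n" for k
    using that c0 by (auto simp: d_def)
  ultimately show ?case
    unfolding deg_stirling2_family_def by blast
qed

lemma deg_stirling2_family_unique:
  assumes "deg_stirling2_family \<mu> n c" "deg_stirling2_family \<mu> n d"
  shows "c = d"
proof
  have eq: "(\<Sum>k=0..n. c k * deg_ffact 1 k x) = (\<Sum>k=0..n. d k * deg_ffact 1 k x)" for x
    using assms unfolding deg_stirling2_family_def by metis
  have van: "deg_ffact 1 k (real m) = 0" if "m < k" for k m
    using that by (auto simp: deg_ffact_def)
  have nv: "deg_ffact 1 m (real m) \<noteq> 0" for m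
    by (auto simp: deg_ffact_def)
  fix m
  show "c m = d m"
  proof (induction m rule: less_induct)
    case (less m)
    show ?case
    proof (cases "m \<le> n")
      case False
      then show ?thesis
        using assms by (simp add: deg_stirling2_family_def)
    next
      case True
      have "0 = (\<Sum>k=0..n. (c k - d k) * deg_ffact 1 k (real m))"
        using eq[of "real m"] by (simp add: algebra_simps sum_subtractf)
      also have "\<dots> = (\<Sum>k\<in>{m}. (c k - d k) * deg_ffact 1 k (real m))"
      proof (rule sum.mono_neutral_right)
        show "\<forall>k\<in>{0..n} - {m}. (c k - d k) * deg_ffact 1 k (real m) = 0"
        proof
          fix k assume "k \<in> {0..n} - {m}"
          then have "k < m \<or> m < k" by auto
          then show "(c k - d k) * deg_ffact 1 k (real m) = 0"
            using less.IH[of k] van[of m k] by auto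
        qed
      qed (use True in auto)
      finally show ?thesis using nv[of m] by simp
    qed
  qed
qed

lemma deg_stirling2:
  "deg_ffact \<mu> n x = (\<Sum>k=0..n. deg_stirling2 \<mu> n k * deg_ffact 1 k x)"
proof -
  have "deg_stirling2_family \<mu> n (deg_stirling2 \<mu> n)"
    unfolding deg_stirling2_def
    by (rule theI'[of "deg_stirling2_family \<mu> n"])
       (use deg_stirling2_family_exists deg_stirling2_family_unique in blast)
  then show ?thesis
    unfolding deg_stirling2_family_def by blast
qed

end

theory Submission
  imports Defs "HOL-Computational_Algebra.Polynomial"
begin

text \<open>Write \<open>B = t / (e\<^sub>\<lambda>(t) - 1)\<close>. For fixed \<open>n\<close> the coefficient of \<open>t\<^sup>n\<close> in \<open>B\<^sup>a\<close> is a
  polynomial in \<open>a\<close> of degree at most \<open>n\<close>, hence it is determined by its values at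
  \<open>a = 0, -1, \<dots>, -n\<close>. At \<open>a = -j\<close> the series \<open>B\<^sup>a\<close> is
  \<open>((e\<^sub>\<lambda>(t) - 1) / t)\<^sup>j\<close>, whose coefficients are degenerate Stirling numbers
  up to factorials, and the claim is Lagrange interpolation at these nodes.\<close>

text \<open>The sum of the Lagrange basis polynomials weighted by the values of \<open>p\<close>
  agrees with \<open>p\<close> on \<open>A\<close>. Both have degree below \<open>card A\<close>, so
  they coincide.\<close>

lemma lagrange_interpolation:
  fixes p :: "'a :: field poly"
  assumes "finite A" "degree p < card A"
  shows "poly p s = (\<Sum>x\<in>A. poly p x * (\<Prod>y\<in>A - {x}. (s - y) / (x - y)))"
proof -
  define L where "L x = (\<Prod>y\<in>A - {x}. smult (1 / (x - y)) [:- y, 1:])" for x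
  define q where "q = (\<Sum>x\<in>A. smult (poly p x) (L x))"
  have poly_L: "poly (L x) s = (\<Prod>y\<in>A - {x}. (s - y) / (x - y))" for x s
    unfolding L_def by (simp add: poly_prod diff_divide_distrib)
  have "degree (L x) < card A" if "x \<in> A" for x
  proof -
    have "degree (L x) \<le> (\<Sum>y\<in>A - {x}. degree (smult (1 / (x - y)) [:- y, 1:]))"
      unfolding L_def by (rule order.trans[OF degree_prod_sum_le]) (use assms in auto)
    also have "\<dots> \<le> (\<Sum>y\<in>A - {x}. 1)"
      by (intro sum_mono) (simp add: degree_smult_eq)
    also have "\<dots> < card A"
      using that assms(1) card_Diff1_less[of A x] by simp
    finally show ?thesis .
  qed
  then have "degree q < card A"
    unfolding q_def using assms by (intro degree_sum_less) (auto intro: le_less_trans[OF degree_smult_le])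
  moreover have "poly p x = poly q x" if "x \<in> A" for x
  proof -
    have "poly (L z) x = (if z = x then 1 else 0)" if "z \<in> A" for z
      using that \<open>x \<in> A\<close> assms(1) by (auto simp: poly_L intro!: prod.neutral)
    then have "poly q x = (\<Sum>z\<in>A. if z = x then poly p z else 0)"
      unfolding q_def poly_sum by (intro sum.cong) auto
    then show ?thesis
      using that assms(1) by simp
  qed
  ultimately have "p = q"
    using assms by (intro poly_eqI_degree[of A]) auto
  then have "poly p s = poly q s"
    by simp
  also have "\<dots> = (\<Sum>x\<in>A. poly p x * (\<Prod>y\<in>A - {x}. (s - y) / (x - y)))"
    by (simp add: q_def poly_sum poly_L)
  finally show ?thesis .
qed

lemma gchoose_poly:
  "\<exists>p :: 'a :: field_char_0 poly. degree p \<le> k \<and> (\<forall>a. poly p a = a gchoose k)"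
proof (intro exI conjI allI)
  let ?p = "smult (1 / fact k) (\<Prod>i = 0..<k. [:- of_nat i, 1 :: 'a:])"
  have "degree ?p \<le> (\<Sum>i = 0..<k. degree [:- of_nat i, 1 :: 'a:])"
    using degree_prod_sum_le[of "{0..<k}" "\<lambda>i. [:- of_nat i, 1 :: 'a:]"] by (simp add: o_def)
  then show "degree ?p \<le> k" by simp
  show "poly ?p a = a gchoose k" for a
    by (simp add: poly_prod gbinomial_prod_rev)
qed

lemma fps_cpow_nth:
  "fps_nth (fps_cpow f a) n = (\<Sum>k = 0..n. (a gchoose k) * fps_nth ((f - 1) ^ k) n)"
  unfolding fps_cpow_def by (simp add: fps_compose_nth)

text \<open>Only the terms with \<open>k \<le> n\<close> of the binomial series reach this
  coefficient, and each is a constant times \<open>a gchoose k\<close>, a polynomial in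
  \<open>a\<close> of degree at most \<open>k\<close>.\<close>

lemma fps_cpow_nth_poly:
  obtains p where "degree p \<le> n" "\<And>a. poly p a = fps_nth (fps_cpow f a) n"
proof -
  obtain g :: "nat \<Rightarrow> complex poly"
    where g: "\<And>k. degree (g k) \<le> k" "\<And>k a. poly (g k) a = a gchoose k"
    using gchoose_poly by metis
  let ?p = "\<Sum>k = 0..n. smult (fps_nth ((f - 1) ^ k) n) (g k)"
  have "degree ?p \<le> n"
    using g(1) by (intro degree_sum_le) (auto intro!: order.trans[OF degree_smult_le] intro: order.trans)
  moreover have "poly ?p a = fps_nth (fps_cpow f a) n" for a
    by (simp add: fps_cpow_nth poly_sum g(2) mult.commute)
  ultimately show thesis by (rule that)
qed

text \<open>By the exponent law this power times \<open>f ^ j\<close> is 1; multiplying by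
  \<open>g ^ j\<close> cancels \<open>f ^ j\<close>.\<close>

lemma fps_cpow_minus_of_nat:
  assumes "fps_nth f 0 = 1" "f * g = 1"
  shows "fps_cpow f (- of_nat j) = g ^ j"
proof -
  have "1 = fps_cpow f (- of_nat j + of_nat j)"
    using fps_cpow_of_nat[OF assms(1), of 0] by simp
  also have "\<dots> = fps_cpow f (- of_nat j) * f ^ j"
    by (simp only: fps_cpow_add[OF assms(1)] fps_cpow_of_nat[OF assms(1)])
  finally have "g ^ j = fps_cpow f (- of_nat j) * (f * g) ^ j"
    by (simp add: power_mult_distrib flip: mult.assoc)
  then show ?thesis
    using assms(2) by simp
qed

text \<open>The \<open>i\<close>-th power is the binomial series with exponent \<open>i / l\<close>
  in the variable \<open>l * t\<close>. Giving each of the \<open>m\<close> factors of the falling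
  factorial one \<open>l\<close> turns \<open>i / l - k\<close> into
  \<open>i - k * l\<close>.\<close>

lemma deg_exp_power_nth:
  assumes "l \<noteq> 0"
  shows "fps_nth (deg_exp l ^ i) m = of_real (deg_ffact l m (of_nat i)) / fact m"
proof -
  have "deg_exp l = fps_binomial (1 / of_real l) oo (fps_const (of_real l) * fps_X)"
    by (simp add: deg_exp_def fps_cpow_def)
  then have "deg_exp l ^ i = fps_binomial (of_nat i / of_real l) oo (fps_const (of_real l) * fps_X)"
    by (simp add: fps_binomial_power fps_compose_power)
  then have "fps_nth (deg_exp l ^ i) m = ((of_nat i / of_real l) gchoose m) * of_real l ^ m"
    by (simp add: fps_compose_linear)
  also have "\<dots> = (\<Prod>k<m. (of_nat i / of_real l - of_nat k) * of_real l) / fact m"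
    by (simp add: gbinomial_prod_rev prod.distrib atLeast0LessThan)
  also have "(\<Prod>k<m. (of_nat i / of_real l - of_nat k) * complex_of_real l)
      = of_real (deg_ffact l m (of_nat i))"
    using assms by (simp add: deg_ffact_def left_diff_distrib)
  finally show ?thesis .
qed

lemma deg_ffact_1_of_nat: "deg_ffact 1 k (of_nat i) = fact k * of_nat (i choose k)"
  by (simp add: deg_ffact_def binomial_gbinomial gbinomial_prod_rev atLeast0LessThan)

text \<open>The transform is lower triangular with diagonal entries \<open>i choose i = 1\<close>,
  so equality propagates by strong induction.\<close>

lemma binomial_transform_inject:
  fixes u v :: "nat \<Rightarrow> 'a :: ring_1"
  assumes "\<And>i. (\<Sum>k\<le>i. of_nat (i choose k) * u k) = (\<Sum>k\<le>i. of_nat (i choose k) * v k)"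
  shows "u i = v i"
proof (induction i rule: less_induct)
  case (less i)
  have "(\<Sum>k<i. of_nat (i choose k) * u k) = (\<Sum>k<i. of_nat (i choose k) * v k)"
    using less by simp
  then show ?case
    using assms[of i] by (simp add: lessThan_Suc_atMost[symmetric])
qed

text \<open>The coefficient of \<open>deg_exp l ^ i\<close> is computed twice: by the binomial
  theorem for \<open>(deg_exp l - 1) + 1\<close>, and by expanding the degenerate falling factorial
  at \<open>i\<close> in Stirling numbers. Both are binomial transforms in \<open>i\<close>, hence
  have equal entries.\<close>

lemma deg_exp_minus_1_power_nth:
  assumes "l \<noteq> 0" "j \<le> m"
  shows "fps_nth ((deg_exp l - 1) ^ j) m = of_real (fact j * deg_stirling2 l m j) / fact m"
proof -
  define u where "u k = fps_nth ((deg_exp l - 1) ^ k) m" for k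
  define v where
    "v k = (if k \<le> m then complex_of_real (fact k * deg_stirling2 l m k) / fact m else 0)" for k
  have "(\<Sum>k\<le>i. of_nat (i choose k) * u k) = (\<Sum>k\<le>i. of_nat (i choose k) * v k)" for i
  proof -
    have "(\<Sum>k\<le>i. of_nat (i choose k) * u k) = fps_nth (((deg_exp l - 1) + 1) ^ i) m"
      unfolding binomial_ring u_def
      by (simp add: fps_sum_nth mult.commute)
    also have "\<dots> = of_real (deg_ffact l m (of_nat i)) / fact m"
      by (simp add: deg_exp_power_nth[OF assms(1)])
    also have "\<dots> = (\<Sum>k\<le>m. of_nat (i choose k) * v k)"
      unfolding deg_stirling2[of l m] v_def
      by (simp add: deg_ffact_1_of_nat sum_divide_distrib atLeast0AtMost mult_ac)
    \<comment> \<open>The bounds \<open>m\<close> and \<open>i\<close> are interchangeable: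
      \<open>i choose k\<close> vanishes for \<open>k > i\<close>, and \<open>v k\<close> is set to
      0 for \<open>k > m\<close>.\<close>
    also have "\<dots> = (\<Sum>k\<le>i. of_nat (i choose k) * v k)"
      by (rule sum.mono_neutral_cong) (auto simp: v_def)
    finally show ?thesis .
  qed
  then have "u j = v j" by (rule binomial_transform_inject)
  then show ?thesis using assms(2) by (simp add: u_def v_def)
qed

lemma deg_bernoulli_minus_of_nat:
  assumes "l \<noteq> 0"
  shows "deg_bernoulli l (- of_nat j) n
    = of_real (deg_stirling2 l (n + j) j) / of_nat ((n + j) choose n)"
proof -
  let ?B = "deg_bernoulli_base l"
  note B = deg_bernoulli_base_mult[OF assms]
  \<comment> \<open>\<open>G\<close> is the series \<open>(deg_exp l - 1) / t\<close>, the inverse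
    of \<open>?B\<close>; in its \<open>j\<close>-th power the index moves from \<open>n\<close> to
    \<open>n + j\<close>.\<close>
  define G where "G = fps_shift 1 (deg_exp l - 1)"
  have "fps_nth (deg_exp l - 1) 0 = 0"
    by (simp add: deg_exp_nth)
  then have G: "deg_exp l - 1 = G * fps_X"
    unfolding G_def by (intro fps_ext) (simp del: fps_sub_nth)
  have "?B * G * fps_X = 1 * fps_X"
    using B(1) by (simp add: G mult.assoc)
  then have "?B * G = 1"
    by (simp only: mult_cancel_right) simp
  then have "deg_bernoulli l (- of_nat j) n = fact n * fps_nth (G ^ j) n"
    unfolding deg_bernoulli_def by (simp add: fps_cpow_minus_of_nat[OF B(2)])
  also have "fps_nth (G ^ j) n = fps_nth ((deg_exp l - 1) ^ j) (n + j)"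
    by (simp add: G power_mult_distrib fps_X_power_mult_right_nth)
  also have "\<dots> = of_real (fact j * deg_stirling2 l (n + j) j) / fact (n + j)"
    by (simp add: deg_exp_minus_1_power_nth[OF assms])
  finally show ?thesis
    by (simp add: binomial_fact)
qed

text \<open>This is the denominator of the Lagrange weight at the node \<open>-j\<close>. The
  factors with \<open>i < j\<close> give the sign and \<open>fact j\<close>, those with
  \<open>i > j\<close> give \<open>fact (n - j)\<close>.\<close>

lemma prod_diff_of_nat:
  assumes "j \<le> n"
  shows "(\<Prod>i\<in>{..n} - {j}. of_nat i - of_nat j :: 'a :: field_char_0) = (-1) ^ j * fact j * fact (n - j)"
proof -
  have eq: "{..n} - {j} = {..<j} \<union> {j<..n}"
    using assms by auto
  have "(\<Prod>i<j. of_nat i - of_nat j :: 'a) = (\<Prod>i<j. - of_nat (Suc i))"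
    \<comment> \<open>Reversing the order of the factors replaces \<open>i - j\<close> by
      \<open>-(i + 1)\<close>.\<close>
    by (rule prod.reindex_bij_witness[of _ "\<lambda>i. j - Suc i" "\<lambda>i. j - Suc i"]) (auto simp: of_nat_diff)
  also have "\<dots> = (-1) ^ j * fact j"
    unfolding prod_uminus fact_prod_Suc by (simp add: atLeast0LessThan del: of_nat_Suc)
  finally have lower: "(\<Prod>i<j. of_nat i - of_nat j :: 'a) = (-1) ^ j * fact j" .
  have "(\<Prod>i\<in>{j<..n}. of_nat i - of_nat j :: 'a) = (\<Prod>i<n - j. of_nat (Suc i))"
    by (rule prod.reindex_bij_witness[of _ "\<lambda>i. i + Suc j" "\<lambda>i. i - Suc j"]) (auto simp: of_nat_diff)
  also have "\<dots> = fact (n - j)"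
    unfolding fact_prod_Suc by (simp add: atLeast0LessThan del: of_nat_Suc)
  finally show ?thesis
    unfolding eq using lower by (subst prod.union_disjoint) auto
qed

lemma prod_add_of_nat:
  fixes a :: "'a :: field_char_0"
  shows "(\<Prod>i\<le>n. a + of_nat i) = fact n * (a * ((a + of_nat n) gchoose n))"
proof -
  have "(\<Prod>i\<le>n. a + of_nat i) = pochhammer a (Suc n)"
    by (simp add: pochhammer_prod atLeast0LessThan lessThan_Suc_atMost)
  also have "\<dots> = a * pochhammer (a + 1) n"
    by (rule pochhammer_rec)
  also have "pochhammer (a + 1) n = fact n * ((a + of_nat n) gchoose n)"
    by (simp add: gbinomial_pochhammer')
  finally show ?thesis by (simp add: mult_ac)
qed

theorem theorem2p19:
  fixes l :: real and n :: nat and a :: complex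
  assumes "l \<noteq> 0"
    and "\<And>j. j \<le> n \<Longrightarrow> a + of_nat j \<noteq> 0"
  shows "deg_bernoulli l a n =
    a * ((a + of_nat n) gchoose n) *
      (\<Sum>j=0..n. (-1) ^ j * of_nat (n choose j)
         * (1 / ((a + of_nat j) * of_nat ((n + j) choose n)))
         * complex_of_real (deg_stirling2 l (n + j) j))"
proof -
  let ?C = "a * ((a + of_nat n) gchoose n)"
  let ?x = "\<lambda>j :: nat. - of_nat j :: complex"
  obtain p where "degree p \<le> n"
    and p: "\<And>a. poly p a = fps_nth (fps_cpow (deg_bernoulli_base l) a) n"
    by (metis fps_cpow_nth_poly)
  have inj: "inj_on ?x A" for A
    by (auto intro: inj_onI)
  have "degree p < card (?x ` {..n})"
    using \<open>degree p \<le> n\<close> by (simp add: card_image[OF inj])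
  then have "poly p a = (\<Sum>x\<in>?x ` {..n}. poly p x * (\<Prod>y\<in>?x ` {..n} - {x}. (a - y) / (x - y)))"
    by (intro lagrange_interpolation) auto
  \<comment> \<open>With \<open>x = -j\<close> and \<open>y = -i\<close>, the differences
    \<open>a - y\<close> and \<open>x - y\<close> become \<open>a + i\<close> and
    \<open>i - j\<close>.\<close>
  also have "\<dots> = (\<Sum>j\<le>n. poly p (?x j) * (\<Prod>i\<in>{..n} - {j}. (a + of_nat i) / (of_nat i - of_nat j)))"
  proof -
    have "?x ` {..n} - {?x j} = ?x ` ({..n} - {j})" for j
      by auto
    then show ?thesis
      by (simp add: sum.reindex[OF inj] prod.reindex[OF inj])
  qed
  finally have "deg_bernoulli l a n = (\<Sum>j\<le>n. deg_bernoulli l (?x j) n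
      * (\<Prod>i\<in>{..n} - {j}. (a + of_nat i) / (of_nat i - of_nat j)))"
    by (simp add: deg_bernoulli_def p sum_distrib_left mult.assoc)
  also have "\<dots> = (\<Sum>j\<le>n. ?C * ((-1) ^ j * of_nat (n choose j)
         * (1 / ((a + of_nat j) * of_nat ((n + j) choose n)))
         * complex_of_real (deg_stirling2 l (n + j) j)))"
  proof (rule sum.cong[OF refl])
    fix j assume "j \<in> {..n}"
    then have j: "j \<le> n" by simp
    \<comment> \<open>The numerator of the weight is the full product divided by its factor at
      \<open>j\<close>, which is nonzero by assumption; this produces the \<open>1 / (a + j)\<close>
      of the claim.\<close>
    have "(\<Prod>i\<le>n. a + of_nat i) = (a + of_nat j) * (\<Prod>i\<in>{..n} - {j}. a + of_nat i)"
      using j by (intro prod.remove) auto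
    then have "(\<Prod>i\<in>{..n} - {j}. a + of_nat i) = fact n * ?C / (a + of_nat j)"
      using assms(2)[OF j] by (simp add: prod_add_of_nat)
    then have "(\<Prod>i\<in>{..n} - {j}. (a + of_nat i) / (of_nat i - of_nat j))
        = fact n * ?C / (a + of_nat j) / ((-1) ^ j * fact j * fact (n - j))"
      by (simp only: prod_dividef prod_diff_of_nat[OF j])
    also have "\<dots> = ?C * ((-1) ^ j * of_nat (n choose j) / (a + of_nat j))"
      \<comment> \<open>The parity split serves to move the sign \<open>(-1) ^ j\<close> from the
        denominator to the numerator.\<close>
      by (cases "even j") (simp_all add: binomial_fact[OF j] mult_ac)
    finally show "deg_bernoulli l (?x j) n
        * (\<Prod>i\<in>{..n} - {j}. (a + of_nat i) / (of_nat i - of_nat j))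
      = ?C * ((-1) ^ j * of_nat (n choose j)
         * (1 / ((a + of_nat j) * of_nat ((n + j) choose n)))
         * complex_of_real (deg_stirling2 l (n + j) j))"
      by (simp add: deg_bernoulli_minus_of_nat[OF assms(1)] mult_ac)
  qed
  finally show ?thesis
    by (simp add: sum_distrib_left atLeast0AtMost)
qed

end
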